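(* Let $\gamma\in\mathbb{C}$ with $0<|\gamma|<1$ be fixed. Then, as $n\to\infty$, $$\lambda_{\gamma,n,j}=\Lambda_{\gamma,n}\left(\frac{j\pi}{n+1}\right)+O\left(\frac{1}{n^3}\right)$$ uniformly in $j\in\{1,\ldots,n\}$, where $$\Lambda_{\gamma,n}(z)=\psi(z)+\frac{\psi'(z)\vartheta_\gamma(z)}{n+1}+\frac{\psi'(z)\vartheta_\gamma(z)\vartheta_\gamma'(z)+\frac12\psi''(z)\vartheta_\gamma(z)^2}{(n+1)^2}.$$
   Context: $A_{\gamma,n}$ is the $n\times n$ matrix $T_n(a)+\gamma E_{n,1,1}$, where $T_n(a)$ is the tridiagonal Toeplitz matrix with entries $(T_n(a))_{j+1,j}=1$, $(T_n(a))_{j,j+1}=-1$ and all other entries $0$, and $E_{n,1,1}$ has entry $(1,1)$ equal to $1$ and all other entries $0$. $\psi(z)=2i\cos(z)$. $\Delta_\gamma=\ln\frac{1}{|\gamma|}$. For $|\operatorname{Im}(z)|<\Delta_\gamma$, $$\vartheta_\gamma(z)=-\frac{i}{2}\ln\left(\frac{1+i\gamma e^{iz}}{1+i\gamma e^{-iz}}\right),$$ where $\ln$ is the principal branch of the logarithm on $\mathbb{C}\setminus(-\infty,0]$ (the argument of the logarithm lies in this set for all such $z$, and $\vartheta_\gamma$ is analytic). Definition of $\lambda_{\gamma,n,j}$: put $d_{n,j}=\frac{j\pi}{n+1}$, $p_{\gamma,n,j}=d_{n,j}+\frac{\vartheta_\gamma(d_{n,j})}{n+1}$, $M_\gamma=\frac{64\sqrt{|\gamma|}}{(1-|\gamma|)^3}$,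 $N_\gamma=\frac{16}{(1-|\gamma|)^2}$, and $\mathcal{B}_{\gamma,n,j}=\{z\in\mathbb{C}\colon |z-p_{\gamma,n,j}|<M_\gamma/(n+1)^2\}$. For every integer $n\ge N_\gamma$ and $j\in\{1,\ldots,n\}$, there is a unique $s_{\gamma,n,j}\in\mathcal{B}_{\gamma,n,j}$ with $s_{\gamma,n,j}=\frac{j\pi}{n+1}+\frac{\vartheta_\gamma(s_{\gamma,n,j})}{n+1}$; define $\lambda_{\gamma,n,j}=\psi(s_{\gamma,n,j})$. The numbers $\lambda_{\gamma,n,1},\ldots,\lambda_{\gamma,n,n}$ are pairwise distinct and are the eigenvalues of $A_{\gamma,n}$. The $O$-constant may depend on $\gamma$ but not on $n$ or $j$. *)

theory Defs
  imports "HOL-Complex_Analysis.Complex_Analysis"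
begin

definition psi :: "complex \<Rightarrow> complex" where
  "psi z = 2 * \<i> * cos z"

text \<open>
  The logarithm is the principal branch. The function is meant on the strip
  \<open>\<bar>Im z\<bar> < ln (1 / cmod \<gamma>)\<close>, where it is analytic; its values elsewhere are irrelevant.
\<close>

definition theta :: "complex \<Rightarrow> complex \<Rightarrow> complex" where
  "theta \<gamma> z =
     - (\<i> / 2) * Ln ((1 + \<i> * \<gamma> * exp (\<i> * z)) / (1 + \<i> * \<gamma> * exp (- \<i> * z)))"

definition d_pt :: "nat \<Rightarrow> nat \<Rightarrow> real" where
  "d_pt n j = real j * pi / (real n + 1)"

definition p_pt :: "complex \<Rightarrow> nat \<Rightarrow> nat \<Rightarrow> complex" where
  "p_pt \<gamma> n j = of_real (d_pt n j) + theta \<gamma> (of_real (d_pt n j)) / (of_nat n + 1)"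

definition M_const :: "complex \<Rightarrow> real" where
  "M_const \<gamma> = 64 * sqrt (cmod \<gamma>) / (1 - cmod \<gamma>) ^ 3"

definition B_disc :: "complex \<Rightarrow> nat \<Rightarrow> nat \<Rightarrow> complex set" where
  "B_disc \<gamma> n j = ball (p_pt \<gamma> n j) (M_const \<gamma> / (real n + 1) ^ 2)"

text \<open>
  For \<open>0 < cmod \<gamma> < 1\<close>, \<open>n \<ge> 16 / (1 - cmod \<gamma>)\<^sup>2\<close> and \<open>1 \<le> j \<le> n\<close>, the disc lies in the
  strip above and contains exactly one solution of the equation below. For other arguments
  the value is unspecified.
\<close>

definition s_pt :: "complex \<Rightarrow> nat \<Rightarrow> nat \<Rightarrow> complex" where
  "s_pt \<gamma> n j =
     (THE s. s \<in> B_disc \<gamma> n j \<and>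
             s = of_real (d_pt n j) + theta \<gamma> s / (of_nat n + 1))"

definition lambda_val :: "complex \<Rightarrow> nat \<Rightarrow> nat \<Rightarrow> complex" where
  "lambda_val \<gamma> n j = psi (s_pt \<gamma> n j)"

definition Lambda_approx :: "complex \<Rightarrow> nat \<Rightarrow> complex \<Rightarrow> complex" where
  "Lambda_approx \<gamma> n z =
     psi z
     + deriv psi z * theta \<gamma> z / (of_nat n + 1)
     + (deriv psi z * theta \<gamma> z * deriv (theta \<gamma>) z
        + 1 / 2 * deriv (deriv psi) z * (theta \<gamma> z) ^ 2) / (of_nat n + 1) ^ 2"

end

theory Submission imports Defs "HOL-Real_Asymp.Real_Asymp" begin

text \<open>
  Write \<open>h = 1 / (n + 1)\<close> and let \<open>d = j\<pi> / (n + 1)\<close>, a real number. The point \<open>s\<close> that defines the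
  eigenvalue solves \<open>s = d + h \<theta>(s)\<close>, so \<open>s\<close> is a perturbation of \<open>d\<close> of size \<open>O(h)\<close>. Inserting the
  equation into itself and expanding \<open>\<theta>\<close> about \<open>d\<close> gives
  \<open>s - d = h \<theta>(d) + h\<^sup>2 \<theta>(d) \<theta>'(d) + O(h\<^sup>3)\<close>, and the expansion of \<open>\<psi>\<close> about \<open>d\<close> to second order in
  \<open>s - d\<close> then produces exactly the claimed approximation. This substitution is
  \<open>second_order_expansion\<close>.

  Uniformity in \<open>j\<close> comes from working on a horizontal strip \<open>\<bar>Im z\<bar> \<le> \<delta>\<close> with
  \<open>r = \<bar>\<gamma>\<bar> exp \<delta> < 1\<close>. There both \<open>w = i\<gamma> exp(iz)\<close> and \<open>v = i\<gamma> exp(-iz)\<close> have modulus at most \<open>r\<close>, so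
  \<open>1 + w\<close> and \<open>1 + v\<close> stay in the right half-plane, \<open>\<theta> = -(i/2) (Ln (1 + w) - Ln (1 + v))\<close>, and
  \<open>\<theta>\<close> and its first two derivatives have bounds that depend on \<open>r\<close> only.

  Since \<open>s\<close> is given by a definite description, it must also be shown that the equation has exactly one
  solution in the prescribed disc about \<open>d + h \<theta>(d)\<close>. With \<open>K = r / (1 - r)\<close>, which
  bounds both \<open>\<theta>\<close> and its Lipschitz constant, \<open>z \<mapsto> d + h \<theta>(z)\<close> is for large \<open>n\<close> a contraction of
  the disc of radius \<open>\<delta>\<close> about \<open>d\<close>. Its fixed point is within \<open>K\<^sup>2 h\<^sup>2\<close> of \<open>d + h \<theta>(d)\<close>, and for the
  choice \<open>r = \<surd>\<bar>\<gamma>\<bar>\<close> the number \<open>K\<^sup>2\<close> is smaller than the constant \<open>M\<close> in the radius of the prescribed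
  disc (\<open>M_const_dominates\<close>). As that smaller disc lies in the larger one, uniqueness is inherited.
\<close>

section \<open>The symbol on a horizontal strip\<close>

lemma psi_has_derivs:
  "(psi has_field_derivative - 2 * \<i> * sin z) (at z)"
  "((\<lambda>z. - 2 * \<i> * sin z) has_field_derivative - 2 * \<i> * cos z) (at z)"
  "((\<lambda>z. - 2 * \<i> * cos z) has_field_derivative 2 * \<i> * sin z) (at z)"
  unfolding psi_def[abs_def] by (auto intro!: derivative_eq_intros)

lemma deriv_psi: "deriv psi = (\<lambda>z. - 2 * \<i> * sin z)"
  and deriv_deriv_psi: "deriv (deriv psi) = (\<lambda>z. - 2 * \<i> * cos z)"
proof -
  show *: "deriv psi = (\<lambda>z. - 2 * \<i> * sin z)"
    by (intro ext DERIV_imp_deriv psi_has_derivs)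
  show "deriv (deriv psi) = (\<lambda>z. - 2 * \<i> * cos z)"
    unfolding * by (intro ext DERIV_imp_deriv psi_has_derivs)
qed

lemma cmod_sin_le_exp_Im: "cmod (sin z) \<le> exp \<bar>Im z\<bar>"
proof -
  have "exp (Im z) \<le> exp \<bar>Im z\<bar>" "exp (- Im z) \<le> exp \<bar>Im z\<bar>"
    by simp_all
  then have "exp (Im z) + exp (- Im z) \<le> exp \<bar>Im z\<bar> * 2"
    by linarith
  then show ?thesis
    by (auto simp: sin_exp_eq norm_divide norm_mult intro: order_trans [OF norm_triangle_ineq4])
qed

definition strip :: "real \<Rightarrow> complex set" where
  "strip \<delta> = {z. \<bar>Im z\<bar> \<le> \<delta>}"

lemma convex_strip: "convex (strip \<delta>)"
proof -
  have "strip \<delta> = {z. Im z \<ge> - \<delta>} \<inter> {z. Im z \<le> \<delta>}"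
    by (auto simp: strip_def)
  then show ?thesis
    by (simp add: convex_Int convex_halfspace_Im_ge convex_halfspace_Im_le)
qed

lemma cball_subset_strip:
  assumes "Im d = 0" shows "cball d \<delta> \<subseteq> strip \<delta>"
proof
  fix z assume "z \<in> cball d \<delta>"
  then have "cmod (z - d) \<le> \<delta>"
    by (simp add: dist_norm norm_minus_commute)
  then show "z \<in> strip \<delta>"
    using abs_Im_le_cmod[of "z - d"] assms by (simp add: strip_def)
qed

lemma psi_Taylor:
  assumes "d \<in> strip \<delta>" "s \<in> strip \<delta>"
  shows "cmod (psi s - psi d - deriv psi d * (s - d) - deriv (deriv psi) d * (s - d)\<^sup>2 / 2)
           \<le> exp \<delta> * cmod (s - d) ^ 3"
proof -
  define f where "f i = (case i of 0 \<Rightarrow> psi | Suc 0 \<Rightarrow> (\<lambda>z. - 2 * \<i> * sin z)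
       | Suc (Suc 0) \<Rightarrow> (\<lambda>z. - 2 * \<i> * cos z) | _ \<Rightarrow> (\<lambda>z. 2 * \<i> * sin z))" for i :: nat
  (* The remainder bound of complex_Taylor has n! in the denominator, not (n+1)!;
     the resulting 2 cancels the factor 2 of psi. *)
  have "cmod (f 0 s - (\<Sum>i\<le>2. f i d * (s - d) ^ i / fact i))
          \<le> (2 * exp \<delta>) * cmod (s - d) ^ Suc 2 / fact 2"
  proof (rule complex_Taylor[OF convex_strip])
    fix i :: nat and x assume "i \<le> 2"
    then consider "i = 0" | "i = 1" | "i = 2" by linarith
    then show "(f i has_field_derivative f (Suc i) x) (at x within strip \<delta>)"
      using psi_has_derivs[of x, THEN has_field_derivative_at_within]
      by cases (simp_all add: f_def numeral_2_eq_2)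
  next
    fix x assume "x \<in> strip \<delta>"
    then have "exp \<bar>Im x\<bar> \<le> exp \<delta>" by (simp add: strip_def)
    then show "cmod (f (Suc 2) x) \<le> 2 * exp \<delta>"
      using order_trans[OF cmod_sin_le_exp_Im[of x]] by (simp add: f_def norm_mult numeral_2_eq_2)
  qed (use assms in auto)
  moreover have "f 0 s - (\<Sum>i\<le>2. f i d * (s - d) ^ i / fact i)
      = psi s - psi d - deriv psi d * (s - d) - deriv (deriv psi) d * (s - d)\<^sup>2 / 2"
    unfolding deriv_deriv_psi unfolding deriv_psi by (simp add: f_def numeral_2_eq_2)
  ultimately show ?thesis
    by (simp add: numeral_3_eq_3 power2_eq_square mult_ac)
qed

section \<open>Logarithms in the right half-plane\<close>

lemma one_plus_right_halfplane:
  assumes "cmod w \<le> r" "r < 1"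
  shows "Re (1 + w) > 0" "1 + w \<noteq> 0" "1 - r \<le> cmod (1 + w)"
proof -
  show "Re (1 + w) > 0"
    using abs_Re_le_cmod[of w] assms by simp
  then show "1 + w \<noteq> 0" by (metis less_irrefl zero_complex.sel(1))
  show "1 - r \<le> cmod (1 + w)"
    using norm_diff_ineq[of 1 w] assms by simp
qed

text \<open>
  The derivative \<open>1 / (1 + z)\<close> is at most \<open>1 / (1 - r)\<close> in modulus on the convex disc of radius \<open>r\<close>, so
  the mean value inequality between \<open>0\<close> and \<open>w\<close> applies.
\<close>

lemma cmod_Ln_1_plus_le:
  assumes "cmod w \<le> r" "r < 1"
  shows "cmod (Ln (1 + w)) \<le> r / (1 - r)"
proof -
  have r: "0 \<le> r" using assms(1) norm_ge_zero order_trans by blast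
  note half = one_plus_right_halfplane[OF _ assms(2)]
  have "cmod (Ln (1 + w) - Ln (1 + 0)) \<le> 1 / (1 - r) * cmod (w - 0)"
  proof (rule field_differentiable_bound[of "cball 0 r" _ "\<lambda>z. 1 / (1 + z)"])
    fix z :: complex assume z: "z \<in> cball 0 r"
    show "((\<lambda>z. Ln (1 + z)) has_field_derivative 1 / (1 + z)) (at z within cball 0 r)"
      using half(1,2)[of z] z
      by (auto intro!: derivative_eq_intros simp: complex_nonpos_Reals_iff field_simps)
    show "norm (1 / (1 + z)) \<le> 1 / (1 - r)"
      using half(3)[of z] z assms(2) by (simp add: norm_divide frac_le)
  qed (use assms r in auto)
  also have "\<dots> \<le> r / (1 - r)"
    using assms by (simp add: divide_right_mono)
  finally show ?thesis by simp
qed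

text \<open>
  Each of the two arguments is less than \<open>\<pi>/2\<close> in modulus, so their difference stays in the range of the
  principal branch.
\<close>

lemma Ln_divide_right_halfplane:
  assumes "Re a > 0" "Re b > 0"
  shows "Ln (a / b) = Ln a - Ln b"
proof (rule Ln_unique)
  have "a \<noteq> 0" "b \<noteq> 0" using assms by auto
  then show "exp (Ln a - Ln b) = a / b" by (simp add: exp_diff)
  show "- pi < Im (Ln a - Ln b)" "Im (Ln a - Ln b) \<le> pi"
    using Re_Ln_pos_lt_imp[OF assms(1)] Re_Ln_pos_lt_imp[OF assms(2)] by auto
qed

section \<open>Uniform bounds for the phase function and its derivatives\<close>

text \<open>
  The two exponentials in \<open>theta\<close> are the values of this single function at \<open>z\<close> and \<open>- z\<close>.
\<close>

definition wave :: "complex \<Rightarrow> complex \<Rightarrow> complex" where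
  "wave \<gamma> z = \<i> * \<gamma> * exp (\<i> * z)"

definition theta_d1 :: "complex \<Rightarrow> complex \<Rightarrow> complex" where
  "theta_d1 \<gamma> z = (wave \<gamma> z / (1 + wave \<gamma> z) + wave \<gamma> (- z) / (1 + wave \<gamma> (- z))) / 2"

definition theta_d2 :: "complex \<Rightarrow> complex \<Rightarrow> complex" where
  "theta_d2 \<gamma> z =
     \<i> * (wave \<gamma> z / (1 + wave \<gamma> z)\<^sup>2 - wave \<gamma> (- z) / (1 + wave \<gamma> (- z))\<^sup>2) / 2"

lemma wave_has_derivs:
  "(wave \<gamma> has_field_derivative \<i> * wave \<gamma> z) (at z)"
  "((\<lambda>z. wave \<gamma> (- z)) has_field_derivative - \<i> * wave \<gamma> (- z)) (at z)"
  unfolding wave_def[abs_def] by (auto intro!: derivative_eq_intros)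

lemma theta_wave: "theta \<gamma> z = - (\<i> / 2) * Ln ((1 + wave \<gamma> z) / (1 + wave \<gamma> (- z)))"
  by (simp add: theta_def wave_def)

lemma cmod_wave_le: "cmod (wave \<gamma> z) \<le> cmod \<gamma> * exp \<bar>Im z\<bar>"
  by (auto simp: wave_def norm_mult intro!: mult_left_mono)

text \<open>
  The hypothesis describes the strip of analyticity \<open>\<bar>Im z\<bar> < ln (1 / \<bar>\<gamma>\<bar>)\<close>. Splitting the logarithm of
  the quotient reduces every estimate for \<open>theta\<close> to one for a single exponential.
\<close>

lemma theta_eq_Ln_diff:
  assumes "cmod \<gamma> * exp \<bar>Im z\<bar> < 1"
  shows "theta \<gamma> z = - (\<i> / 2) * (Ln (1 + wave \<gamma> z) - Ln (1 + wave \<gamma> (- z)))"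
  using one_plus_right_halfplane(1)[OF cmod_wave_le[of \<gamma> z] assms]
    one_plus_right_halfplane(1)[OF cmod_wave_le[of \<gamma> "- z"]] assms
  by (simp add: theta_wave Ln_divide_right_halfplane)

lemma theta_has_derivs:
  assumes "cmod \<gamma> * exp \<bar>Im z\<bar> < 1"
  shows "(theta \<gamma> has_field_derivative theta_d1 \<gamma> z) (at z)"
    and "(theta_d1 \<gamma> has_field_derivative theta_d2 \<gamma> z) (at z)"
proof -
  have p: "Re (1 + wave \<gamma> z) > 0" and n: "Re (1 + wave \<gamma> (- z)) > 0"
    using one_plus_right_halfplane(1)[OF cmod_wave_le[of \<gamma> z] assms]
      one_plus_right_halfplane(1)[OF cmod_wave_le[of \<gamma> "- z"]] assms by auto
  then have nz: "1 + wave \<gamma> z \<noteq> 0" "1 + wave \<gamma> (- z) \<noteq> 0"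
    by (metis less_irrefl zero_complex.sel(1))+
  (* The splitting of the logarithm must hold on a neighbourhood of z to transfer the derivative. *)
  define U where "U = {z. cmod \<gamma> * exp \<bar>Im z\<bar> < 1}"
  have "open U"
    unfolding U_def by (intro open_Collect_less continuous_intros)
  have Ln_chain: "((\<lambda>z. Ln (1 + g z)) has_field_derivative g' / (1 + g z)) (at z)"
    if "(g has_field_derivative g') (at z)" "Re (1 + g z) > 0" for g g'
  proof -
    have "1 + g z \<notin> \<real>\<^sub>\<le>\<^sub>0" using that(2) by (simp add: complex_nonpos_Reals_iff)
    from DERIV_chain2[OF has_field_derivative_Ln[OF this] DERIV_add[OF DERIV_const that(1)]]
    show ?thesis by (simp add: divide_inverse mult.commute)
  qed
  have "((\<lambda>z. - (\<i> / 2) * (Ln (1 + wave \<gamma> z) - Ln (1 + wave \<gamma> (- z))))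
          has_field_derivative
          - (\<i> / 2) * (\<i> * wave \<gamma> z / (1 + wave \<gamma> z) - - \<i> * wave \<gamma> (- z) / (1 + wave \<gamma> (- z)))) (at z)"
    by (intro DERIV_cmult DERIV_diff Ln_chain wave_has_derivs p n)
  also have "- (\<i> / 2) * (\<i> * wave \<gamma> z / (1 + wave \<gamma> z) - - \<i> * wave \<gamma> (- z) / (1 + wave \<gamma> (- z)))
      = theta_d1 \<gamma> z"
    by (simp add: theta_d1_def algebra_simps add_divide_distrib)
  finally have "((\<lambda>z. - (\<i> / 2) * (Ln (1 + wave \<gamma> z) - Ln (1 + wave \<gamma> (- z))))
          has_field_derivative theta_d1 \<gamma> z) (at z)" .
  then show "(theta \<gamma> has_field_derivative theta_d1 \<gamma> z) (at z)"
    by (rule has_field_derivative_transform_within_open[OF _ \<open>open U\<close>])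
       (use assms in \<open>auto simp: U_def theta_eq_Ln_diff\<close>)
  have quotient_chain: "((\<lambda>z. g z / (1 + g z)) has_field_derivative g' / (1 + g z)\<^sup>2) (at z)"
    if "(g has_field_derivative g') (at z)" "1 + g z \<noteq> 0" for g g'
  proof -
    have "g' * (1 + g z) - g z * (0 + g') = g'" by (simp add: algebra_simps)
    with DERIV_divide[OF that(1) DERIV_add[OF DERIV_const that(1)] that(2)]
    show ?thesis by (simp only: power2_eq_square)
  qed
  have "(theta_d1 \<gamma> has_field_derivative
          (\<i> * wave \<gamma> z / (1 + wave \<gamma> z)\<^sup>2 + - \<i> * wave \<gamma> (- z) / (1 + wave \<gamma> (- z))\<^sup>2) / 2) (at z)"
    unfolding theta_d1_def[abs_def]
    by (intro DERIV_cdivide DERIV_add quotient_chain wave_has_derivs nz)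
  then show "(theta_d1 \<gamma> has_field_derivative theta_d2 \<gamma> z) (at z)"
    by (simp add: theta_d2_def right_diff_distrib)
qed

lemma
  assumes "cmod \<gamma> * exp \<bar>Im z\<bar> \<le> r" "r < 1"
  shows cmod_theta_le: "cmod (theta \<gamma> z) \<le> r / (1 - r)"
    and cmod_theta_d1_le: "cmod (theta_d1 \<gamma> z) \<le> r / (1 - r)"
    and cmod_theta_d2_le: "cmod (theta_d2 \<gamma> z) \<le> r / (1 - r)\<^sup>2"
proof -
  let ?w = "wave \<gamma> z" and ?v = "wave \<gamma> (- z)"
  have w: "cmod ?w \<le> r" and v: "cmod ?v \<le> r"
    using cmod_wave_le[of \<gamma> z] cmod_wave_le[of \<gamma> "- z"] assms(1) by auto
  have lt: "cmod \<gamma> * exp \<bar>Im z\<bar> < 1" using assms by simp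
  have "cmod (theta \<gamma> z) \<le> (cmod (Ln (1 + ?w)) + cmod (Ln (1 + ?v))) / 2"
    unfolding theta_eq_Ln_diff[OF lt]
    by (simp add: norm_mult norm_divide norm_triangle_ineq4)
  also have "\<dots> \<le> r / (1 - r)"
    using cmod_Ln_1_plus_le[OF w assms(2)] cmod_Ln_1_plus_le[OF v assms(2)] by argo
  finally show "cmod (theta \<gamma> z) \<le> r / (1 - r)" .
  have q: "cmod (x / (1 + x) ^ k) \<le> r / (1 - r) ^ k" if "cmod x \<le> r" for x k
    unfolding norm_divide norm_power
    using one_plus_right_halfplane[OF that assms(2)] that assms(2) norm_ge_zero[of x]
    by (intro frac_le power_mono zero_less_power) linarith+
  have "cmod (theta_d1 \<gamma> z) \<le> (cmod (?w / (1 + ?w)) + cmod (?v / (1 + ?v))) / 2"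
    unfolding theta_d1_def by (simp add: norm_divide[of _ 2] norm_triangle_ineq)
  also have "\<dots> \<le> r / (1 - r)"
    using q[OF w, of 1] q[OF v, of 1] unfolding power_one_right by argo
  finally show "cmod (theta_d1 \<gamma> z) \<le> r / (1 - r)" .
  have "cmod (theta_d2 \<gamma> z) \<le> (cmod (?w / (1 + ?w)\<^sup>2) + cmod (?v / (1 + ?v)\<^sup>2)) / 2"
    unfolding theta_d2_def by (simp add: norm_mult norm_divide[of _ 2] norm_triangle_ineq4)
  also have "\<dots> \<le> r / (1 - r)\<^sup>2"
    using q[OF w, of 2] q[OF v, of 2] by argo
  finally show "cmod (theta_d2 \<gamma> z) \<le> r / (1 - r)\<^sup>2" .
qed

lemma strip_wave_bound:
  assumes "z \<in> strip \<delta>"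
  shows "cmod \<gamma> * exp \<bar>Im z\<bar> \<le> cmod \<gamma> * exp \<delta>"
  using assms by (auto simp: strip_def intro!: mult_left_mono)

lemma theta_Lipschitz:
  assumes "cmod \<gamma> * exp \<delta> = r" "r < 1" "x \<in> strip \<delta>" "y \<in> strip \<delta>"
  shows "cmod (theta \<gamma> x - theta \<gamma> y) \<le> r / (1 - r) * cmod (x - y)"
proof (rule field_differentiable_bound[OF convex_strip])
  fix z assume "z \<in> strip \<delta>"
  then have *: "cmod \<gamma> * exp \<bar>Im z\<bar> \<le> r"
    using strip_wave_bound assms(1) by blast
  then have "cmod \<gamma> * exp \<bar>Im z\<bar> < 1"
    using assms(2) by linarith
  then show "(theta \<gamma> has_field_derivative theta_d1 \<gamma> z) (at z within strip \<delta>)"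
    by (rule theta_has_derivs(1)[THEN has_field_derivative_at_within])
  show "cmod (theta_d1 \<gamma> z) \<le> r / (1 - r)"
    using * assms(2) by (rule cmod_theta_d1_le)
qed (use assms in auto)

text \<open>
  The remainder constant is independent of the base point \<open>d\<close>; this is what makes the final error
  uniform in \<open>j\<close>.
\<close>

lemma theta_Taylor:
  assumes "cmod \<gamma> * exp \<delta> = r" "r < 1" "d \<in> strip \<delta>" "s \<in> strip \<delta>"
  shows "cmod (theta \<gamma> s - theta \<gamma> d - theta_d1 \<gamma> d * (s - d)) \<le> r / (1 - r)\<^sup>2 * cmod (s - d) ^ 2"
proof -
  define f where "f i = (case i of 0 \<Rightarrow> theta \<gamma> | Suc 0 \<Rightarrow> theta_d1 \<gamma> | _ \<Rightarrow> theta_d2 \<gamma>)" for i :: nat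
  have "cmod (f 0 s - (\<Sum>i\<le>1. f i d * (s - d) ^ i / fact i))
          \<le> (r / (1 - r)\<^sup>2) * cmod (s - d) ^ Suc 1 / fact 1"
  proof (rule complex_Taylor[OF convex_strip])
    fix i :: nat and x assume "i \<le> 1" and x: "x \<in> strip \<delta>"
    have "cmod \<gamma> * exp \<bar>Im x\<bar> < 1"
      using strip_wave_bound[OF x, of \<gamma>] assms(1,2) by linarith
    note D = theta_has_derivs[OF this, THEN has_field_derivative_at_within]
    consider "i = 0" | "i = 1" using \<open>i \<le> 1\<close> by linarith
    then show "(f i has_field_derivative f (Suc i) x) (at x within strip \<delta>)"
      using D by cases (simp_all add: f_def)
  next
    fix x assume "x \<in> strip \<delta>"
    then show "cmod (f (Suc 1) x) \<le> r / (1 - r)\<^sup>2"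
      using strip_wave_bound[of x \<delta> \<gamma>] assms(1,2) by (auto simp: f_def intro!: cmod_theta_d2_le)
  qed (use assms in auto)
  then show ?thesis
    by (simp add: f_def algebra_simps power2_eq_square)
qed

section \<open>Expanding a composition along an implicit perturbation\<close>

text \<open>
  To be read with \<open>u = s - d\<close>, \<open>\<tau> = \<theta>(s)\<close>, \<open>t = \<theta>(d)\<close>, \<open>t' = \<theta>'(d)\<close>, \<open>a = \<psi>'(d)\<close>, \<open>b = \<psi>''(d)\<close>,
  \<open>y0 = \<psi>(d)\<close> and \<open>y = \<psi>(s)\<close>. The error is the sum of the remainder \<open>y - y0 - a u - b u\<^sup>2 / 2\<close>, of
  \<open>a\<close> times the error of the second-order approximation \<open>h t + h\<^sup>2 t t'\<close> to \<open>u\<close>, and of \<open>b / 2\<close> times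
  the error of \<open>h\<^sup>2 t\<^sup>2\<close> as an approximation to \<open>u\<^sup>2\<close>. Each of the three is of third order in \<open>h\<close>.
\<close>

lemma second_order_expansion:
  fixes h t t' \<tau> u a b y0 y :: complex
  assumes u: "u = h * \<tau>" and K: "0 \<le> K" and L: "0 \<le> L" and P: "0 \<le> P"
    and "cmod \<tau> \<le> K" "cmod t \<le> K" "cmod t' \<le> K" "cmod a \<le> 2" "cmod b \<le> 2"
    and lip: "cmod (\<tau> - t) \<le> K * cmod u"
    and tay: "cmod (\<tau> - t - t' * u) \<le> L * cmod u ^ 2"
    and out: "cmod (y - y0 - a * u - b * u\<^sup>2 / 2) \<le> P * cmod u ^ 3"
  shows "cmod (y - (y0 + a * t * h + (a * t * t' + 1 / 2 * b * t\<^sup>2) * h\<^sup>2))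
           \<le> (P * K ^ 3 + 2 * L * K\<^sup>2 + 4 * K ^ 3) * cmod h ^ 3"
proof -
  let ?h = "cmod h"
  have u_le: "cmod u \<le> K * ?h"
    using mult_right_mono[OF assms(5), of ?h] by (simp add: u norm_mult mult.commute)
  have first: "cmod (u - h * t) \<le> K\<^sup>2 * ?h\<^sup>2"
  proof -
    have "cmod (u - h * t) = ?h * cmod (\<tau> - t)"
      by (simp add: u norm_mult flip: right_diff_distrib)
    also have "\<dots> \<le> ?h * (K * (K * ?h))"
      by (intro mult_left_mono order_trans[OF lip] u_le K) auto
    finally show ?thesis by (simp add: power2_eq_square mult_ac)
  qed
  have second: "cmod (u - h * t - h\<^sup>2 * t * t') \<le> (L * K\<^sup>2 + K ^ 3) * ?h ^ 3"
  proof -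
    have "u - h * t - h\<^sup>2 * t * t' = h * (\<tau> - t - t' * u) + h * t' * (u - h * t)"
      by (simp add: u algebra_simps power2_eq_square)
    then have "cmod (u - h * t - h\<^sup>2 * t * t')
                 \<le> ?h * cmod (\<tau> - t - t' * u) + ?h * cmod t' * cmod (u - h * t)"
      using norm_triangle_ineq[of "h * (\<tau> - t - t' * u)" "h * t' * (u - h * t)"]
      by (simp add: norm_mult)
    also have "\<dots> \<le> ?h * (L * (K * ?h)\<^sup>2) + ?h * K * (K\<^sup>2 * ?h\<^sup>2)"
      by (intro add_mono mult_mono order_trans[OF tay] power_mono u_le assms first) (auto simp: K L)
    also have "\<dots> = (L * K\<^sup>2 + K ^ 3) * ?h ^ 3"
      by (simp add: algebra_simps power2_eq_square power3_eq_cube)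
    finally show ?thesis .
  qed
  have square: "cmod (u\<^sup>2 - (h * t)\<^sup>2) \<le> 2 * K ^ 3 * ?h ^ 3"
  proof -
    have "cmod (h * t) \<le> K * ?h"
      using mult_right_mono[OF assms(6), of ?h] by (simp add: norm_mult mult.commute)
    then have "cmod (u + h * t) \<le> 2 * K * ?h"
      using norm_triangle_ineq[of u "h * t"] u_le by linarith
    then have "cmod (u - h * t) * cmod (u + h * t) \<le> (K\<^sup>2 * ?h\<^sup>2) * (2 * K * ?h)"
      by (intro mult_mono first) auto
    moreover have "u\<^sup>2 - (h * t)\<^sup>2 = (u - h * t) * (u + h * t)"
      by (simp add: algebra_simps power2_eq_square)
    ultimately show ?thesis
      by (simp add: norm_mult power2_eq_square power3_eq_cube mult_ac)
  qed
  have cube: "cmod (y - y0 - a * u - b * u\<^sup>2 / 2) \<le> P * (K * ?h) ^ 3"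
    by (intro order_trans[OF out] mult_left_mono power_mono u_le P) auto
  have "y - (y0 + a * t * h + (a * t * t' + 1 / 2 * b * t\<^sup>2) * h\<^sup>2)
      = (y - y0 - a * u - b * u\<^sup>2 / 2) + a * (u - h * t - h\<^sup>2 * t * t') + (b / 2) * (u\<^sup>2 - (h * t)\<^sup>2)"
    by (simp add: field_simps power2_eq_square)
  also have "cmod \<dots> \<le> cmod (y - y0 - a * u - b * u\<^sup>2 / 2)
       + cmod a * cmod (u - h * t - h\<^sup>2 * t * t') + cmod (b / 2) * cmod (u\<^sup>2 - (h * t)\<^sup>2)"
    unfolding norm_mult[symmetric]
    by (rule order_trans[OF norm_triangle_ineq add_right_mono[OF norm_triangle_ineq]])
  also have "\<dots> \<le> P * (K * ?h) ^ 3 + 2 * ((L * K\<^sup>2 + K ^ 3) * ?h ^ 3) + 1 * (2 * K ^ 3 * ?h ^ 3)"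
    by (intro add_mono mult_mono cube second square assms) (use assms K in \<open>auto simp: norm_divide\<close>)
  also have "\<dots> = (P * K ^ 3 + 2 * L * K\<^sup>2 + 4 * K ^ 3) * ?h ^ 3"
    by (simp add: algebra_simps power3_eq_cube)
  finally show ?thesis .
qed

section \<open>The fixed point in the prescribed disc\<close>

lemma fixed_point_in_strip:
  assumes g: "cmod \<gamma> * exp \<delta> = r" "r < 1" and K: "K = r / (1 - r)" and "0 \<le> K"
    and small: "K * cmod h \<le> \<delta>" "K * cmod h < 1" and d: "Im d = 0"
  shows "\<exists>!s. s \<in> cball d \<delta> \<and> s = d + theta \<gamma> s * h"
proof -
  have sub: "cball d \<delta> \<subseteq> strip \<delta>" using cball_subset_strip[OF d] .
  have bound: "cmod (theta \<gamma> z) \<le> K" if "z \<in> cball d \<delta>" for z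
    using cmod_theta_le[of \<gamma> z r] strip_wave_bound[of z \<delta> \<gamma>] that sub g K by auto
  have \<delta>: "0 \<le> \<delta>" using small(1) \<open>0 \<le> K\<close> by (meson norm_ge_zero mult_nonneg_nonneg order_trans)
  have "\<exists>!s\<in>cball d \<delta>. d + theta \<gamma> s * h = s"
  proof (rule Banach_fix[where c = "K * cmod h"])
    show "(\<lambda>s. d + theta \<gamma> s * h) ` cball d \<delta> \<subseteq> cball d \<delta>"
    proof clarify
      fix s assume "s \<in> cball d \<delta>"
      then have "cmod (theta \<gamma> s) * cmod h \<le> K * cmod h"
        by (intro mult_right_mono bound) auto
      then show "d + theta \<gamma> s * h \<in> cball d \<delta>"
        using small(1) by (simp add: dist_norm norm_mult)
    qed
    fix x y assume "x \<in> cball d \<delta>" "y \<in> cball d \<delta>"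
    then have "cmod (theta \<gamma> x - theta \<gamma> y) * cmod h \<le> (K * cmod (x - y)) * cmod h"
      using sub by (intro mult_right_mono theta_Lipschitz[OF g, folded K]) auto
    then show "dist (d + theta \<gamma> x * h) (d + theta \<gamma> y * h) \<le> K * cmod h * dist x y"
      by (simp add: dist_norm norm_mult mult_ac flip: left_diff_distrib right_diff_distrib)
  qed (use \<delta> small \<open>0 \<le> K\<close> in \<open>auto intro: complete_eq_closed[THEN iffD2]\<close>)
  then show ?thesis by metis
qed

lemma cmod_one_over_Suc: "cmod (1 / (of_nat n + 1)) = 1 / (real n + 1)"
proof -
  have "of_nat n + 1 = complex_of_real (real n + 1)" by simp
  then have "cmod (of_nat n + 1) = real n + 1"
    by (metis norm_of_real abs_of_nonneg of_nat_0_le_iff add_nonneg_nonneg zero_le_one)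
  then show ?thesis by (simp add: norm_divide)
qed

text \<open>
  The fixed point \<open>s\<close> of the contraction satisfies \<open>\<bar>s - d\<bar> \<le> K \<bar>h\<bar>\<close>. One more application of the
  Lipschitz bound gives \<open>\<bar>s - (d + h \<theta>(d))\<bar> \<le> K\<^sup>2 \<bar>h\<bar>\<^sup>2\<close>, which is where the hypothesis on the radius
  constant enters: it puts \<open>s\<close> into the disc of the definite description. Conversely that disc lies in
  the domain of the contraction, where no other fixed point exists.
\<close>

lemma s_pt_fixed_point:
  assumes g: "cmod \<gamma> * exp \<delta> = r" "r < 1" and K: "K = r / (1 - r)" "0 < K"
    and M: "K\<^sup>2 < M_const \<gamma>"
    and small: "K / (real n + 1) + M_const \<gamma> / (real n + 1)\<^sup>2 \<le> \<delta>" "K / (real n + 1) < 1"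
  shows "s_pt \<gamma> n j \<in> cball (of_real (d_pt n j)) \<delta>"
    and "s_pt \<gamma> n j = of_real (d_pt n j) + theta \<gamma> (s_pt \<gamma> n j) / (of_nat n + 1)"
proof -
  define d h where "d = complex_of_real (d_pt n j)" and "h = 1 / (of_nat n + 1 :: complex)"
  have h: "cmod h = 1 / (real n + 1)"
    unfolding h_def by (rule cmod_one_over_Suc)
  have th: "theta \<gamma> s / (of_nat n + 1) = theta \<gamma> s * h" for s
    by (simp add: h_def)
  have Kh: "K * cmod h = K / (real n + 1)" by (simp add: h)
  have Mh: "M_const \<gamma> / (real n + 1)\<^sup>2 = M_const \<gamma> * (cmod h)\<^sup>2"
    by (simp add: h power_divide)
  have Mpos: "M_const \<gamma> > 0"
    using M by (meson zero_le_power2 order_le_less_trans)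
  then have Mnonneg: "0 \<le> M_const \<gamma> * (cmod h)\<^sup>2" by simp
  have small': "K * cmod h + M_const \<gamma> * (cmod h)\<^sup>2 \<le> \<delta>"
    using small(1) unfolding Mh Kh[symmetric] .
  then have Kh\<delta>: "K * cmod h \<le> \<delta>" using Mnonneg by linarith
  have d: "Im d = 0" by (simp add: d_def)
  have sub: "cball d \<delta> \<subseteq> strip \<delta>" using cball_subset_strip[OF d] .
  have bound: "cmod (theta \<gamma> z) \<le> K" if "z \<in> cball d \<delta>" for z
    using cmod_theta_le[of \<gamma> z r] strip_wave_bound[of z \<delta> \<gamma>] that sub g K by auto
  have dd: "d \<in> cball d \<delta>"
    using Kh\<delta> K(2) by (auto intro: order_trans[rotated])
  have ex1: "\<exists>!s. s \<in> cball d \<delta> \<and> s = d + theta \<gamma> s * h"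
    using fixed_point_in_strip[OF g K(1) _ Kh\<delta> _ d] K(2) small(2) Kh by simp
  then obtain s where s: "s \<in> cball d \<delta>" "s = d + theta \<gamma> s * h" by blast
  have p: "p_pt \<gamma> n j = d + theta \<gamma> d * h" by (simp add: p_pt_def d_def h_def)
  have B: "B_disc \<gamma> n j = ball (d + theta \<gamma> d * h) (M_const \<gamma> * (cmod h)\<^sup>2)"
    unfolding B_disc_def p Mh ..
  have inB: "s \<in> B_disc \<gamma> n j"
  proof -
    have sd: "cmod (s - d) \<le> K * cmod h"
    proof -
      have "s - d = theta \<gamma> s * h" using s(2) by (metis add_diff_cancel_left')
      then show ?thesis using bound[OF s(1)] by (simp add: norm_mult mult_right_mono)
    qed
    have "s - (d + theta \<gamma> d * h) = (theta \<gamma> s - theta \<gamma> d) * h"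
      using s(2) by (metis add_diff_cancel_left left_diff_distrib)
    then have "cmod (s - (d + theta \<gamma> d * h)) = cmod (theta \<gamma> s - theta \<gamma> d) * cmod h"
      by (simp add: norm_mult)
    also have "\<dots> \<le> (K * cmod (s - d)) * cmod h"
      using s(1) dd sub by (intro mult_right_mono theta_Lipschitz[OF g, folded K(1)]) auto
    also have "\<dots> \<le> (K * (K * cmod h)) * cmod h"
      using sd K(2) by (intro mult_right_mono mult_left_mono) auto
    also have "\<dots> = K\<^sup>2 * (cmod h)\<^sup>2" by (simp add: power2_eq_square)
    also have "\<dots> < M_const \<gamma> * (cmod h)\<^sup>2"
      using M by (intro mult_strict_right_mono) (simp_all add: h)
    finally show ?thesis
      unfolding B by (simp add: dist_norm norm_minus_commute)
  qed
  have Bsub: "B_disc \<gamma> n j \<subseteq> cball d \<delta>"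
  proof
    fix z assume "z \<in> B_disc \<gamma> n j"
    then have "cmod (z - (d + theta \<gamma> d * h)) < M_const \<gamma> * (cmod h)\<^sup>2"
      unfolding B by (simp add: dist_norm norm_minus_commute)
    moreover have "cmod (theta \<gamma> d * h) \<le> K * cmod h"
      using bound[OF dd] by (simp add: norm_mult mult_right_mono)
    moreover have "cmod (z - d) \<le> cmod (z - (d + theta \<gamma> d * h)) + cmod (theta \<gamma> d * h)"
      using norm_triangle_ineq[of "z - (d + theta \<gamma> d * h)" "theta \<gamma> d * h"] by simp
    ultimately show "z \<in> cball d \<delta>"
      using small' by (simp add: dist_norm norm_minus_commute)
  qed
  have "s_pt \<gamma> n j = s"
    unfolding s_pt_def th d_def[symmetric]
    by (rule the_equality) (use s inB Bsub ex1 in blast)+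
  then show "s_pt \<gamma> n j \<in> cball (of_real (d_pt n j)) \<delta>"
    and "s_pt \<gamma> n j = of_real (d_pt n j) + theta \<gamma> (s_pt \<gamma> n j) / (of_nat n + 1)"
    using s by (simp_all add: th flip: d_def)
qed

section \<open>The eigenvalue expansion\<close>

lemma expansion_at_s_pt:
  assumes g: "cmod \<gamma> * exp \<delta> = r" "r < 1" and K: "K = r / (1 - r)" "0 < K"
    and M: "K\<^sup>2 < M_const \<gamma>"
    and small: "K / (real n + 1) + M_const \<gamma> / (real n + 1)\<^sup>2 \<le> \<delta>" "K / (real n + 1) < 1"
  shows "cmod (lambda_val \<gamma> n j - Lambda_approx \<gamma> n (of_real (d_pt n j)))
           \<le> (exp \<delta> * K ^ 3 + 2 * (r / (1 - r)\<^sup>2) * K\<^sup>2 + 4 * K ^ 3) / (real n + 1) ^ 3"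
proof -
  define d h s where "d = complex_of_real (d_pt n j)" and "h = 1 / (of_nat n + 1 :: complex)"
    and "s = s_pt \<gamma> n j"
  have h: "cmod h = 1 / (real n + 1)"
    unfolding h_def by (rule cmod_one_over_Suc)
  have s: "s \<in> strip \<delta>" "s = d + theta \<gamma> s * h"
    using s_pt_fixed_point[OF assms, of j] cball_subset_strip[of d \<delta>]
    by (auto simp: s_def d_def h_def)
  have \<delta>: "0 \<le> \<delta>"
    using s(1) by (auto simp: strip_def)
  then have d: "d \<in> strip \<delta>" by (simp add: strip_def d_def)
  have wave: "cmod \<gamma> * exp \<bar>Im z\<bar> \<le> r" if "z \<in> strip \<delta>" for z
    using strip_wave_bound[OF that, of \<gamma>] g by simp
  have "0 < r" using K g(2) by (simp add: zero_less_divide_iff)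
  have sd: "s - d = h * theta \<gamma> s" using s(2) by (metis add_diff_cancel_left' mult.commute)
  have deriv: "deriv (theta \<gamma>) d = theta_d1 \<gamma> d"
    using wave[OF d] g(2) by (intro DERIV_imp_deriv theta_has_derivs) simp
  have real_trig: "cmod (sin d) \<le> 1" "cmod (cos d) \<le> 1"
    unfolding d_def sin_of_real cos_of_real norm_of_real by auto
  have "cmod (psi s - (psi d + deriv psi d * theta \<gamma> d * h
          + (deriv psi d * theta \<gamma> d * theta_d1 \<gamma> d
             + 1 / 2 * deriv (deriv psi) d * (theta \<gamma> d)\<^sup>2) * h\<^sup>2))
        \<le> (exp \<delta> * K ^ 3 + 2 * (r / (1 - r)\<^sup>2) * K\<^sup>2 + 4 * K ^ 3) * cmod h ^ 3"
  proof (rule second_order_expansion[OF sd])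
    show "cmod (theta \<gamma> s) \<le> K" "cmod (theta \<gamma> d) \<le> K" "cmod (theta_d1 \<gamma> d) \<le> K"
      unfolding K(1) by (intro cmod_theta_le cmod_theta_d1_le wave s d g(2))+
    show "cmod (theta \<gamma> s - theta \<gamma> d) \<le> K * cmod (s - d)"
      unfolding K(1) by (rule theta_Lipschitz[OF g s(1) d])
    show "cmod (theta \<gamma> s - theta \<gamma> d - theta_d1 \<gamma> d * (s - d)) \<le> r / (1 - r)\<^sup>2 * cmod (s - d) ^ 2"
      by (rule theta_Taylor[OF g d s(1)])
    show "cmod (psi s - psi d - deriv psi d * (s - d) - deriv (deriv psi) d * (s - d)\<^sup>2 / 2)
           \<le> exp \<delta> * cmod (s - d) ^ 3"
      by (rule psi_Taylor[OF d s(1)])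
    show "cmod (deriv psi d) \<le> 2" "cmod (deriv (deriv psi) d) \<le> 2"
      unfolding deriv_deriv_psi unfolding deriv_psi using real_trig by (simp_all add: norm_mult)
  qed (use K \<open>0 < r\<close> in auto)
  moreover have "Lambda_approx \<gamma> n d = psi d + deriv psi d * theta \<gamma> d * h
          + (deriv psi d * theta \<gamma> d * theta_d1 \<gamma> d
             + 1 / 2 * deriv (deriv psi) d * (theta \<gamma> d)\<^sup>2) * h\<^sup>2"
    by (simp add: Lambda_approx_def deriv h_def power_divide)
  ultimately show ?thesis
    by (simp add: lambda_val_def s_def d_def h power_divide)
qed

text \<open>
  With \<open>q = \<surd>\<bar>\<gamma>\<bar>\<close> the left-hand side is \<open>q\<^sup>2 (1 + q)\<^sup>2 / (1 - q\<^sup>2)\<^sup>2 \<le> 4 q / (1 - q\<^sup>2)\<^sup>2\<close>.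
\<close>

lemma M_const_dominates:
  assumes "0 < cmod \<gamma>" "cmod \<gamma> < 1"
  shows "(sqrt (cmod \<gamma>) / (1 - sqrt (cmod \<gamma>)))\<^sup>2 < M_const \<gamma>"
proof -
  define q where "q = sqrt (cmod \<gamma>)"
  have q: "0 < q" "q < 1" "cmod \<gamma> = q\<^sup>2"
    using assms by (auto simp: q_def)
  have pos: "0 < 1 - q\<^sup>2" using q by (simp add: power_less_one_iff)
  have fac: "1 - q\<^sup>2 = (1 - q) * (1 + q)" by (simp add: algebra_simps power2_eq_square)
  have "q / (1 - q) = q * (1 + q) / (1 - q\<^sup>2)"
    unfolding fac using q by simp
  then have "(q / (1 - q))\<^sup>2 = (q * (1 + q))\<^sup>2 / (1 - q\<^sup>2)\<^sup>2"
    by (simp add: power_divide)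
  also have "\<dots> < 64 * q / (1 - q\<^sup>2)\<^sup>2"
  proof (rule divide_strict_right_mono)
    have "q * (1 + q)\<^sup>2 \<le> 1 * 2\<^sup>2"
      using q by (intro mult_mono power_mono) auto
    then have "q * (q * (1 + q)\<^sup>2) \<le> q * 4"
      using q by (intro mult_left_mono) auto
    then show "(q * (1 + q))\<^sup>2 < 64 * q"
      using q by (simp add: power2_eq_square mult_ac)
  qed (use pos in simp)
  also have "\<dots> \<le> 64 * q / (1 - q\<^sup>2) ^ 3"
    using q pos by (intro divide_left_mono power_decreasing) auto
  finally show ?thesis
    using q by (simp add: M_const_def flip: q_def)
qed

theorem theorem4:
  fixes \<gamma> :: complex
  assumes "0 < cmod \<gamma>" and "cmod \<gamma> < 1"
  shows "\<exists>C::real. \<forall>\<^sub>F n in sequentially. \<forall>j\<in>{1..n}.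
           cmod (lambda_val \<gamma> n j - Lambda_approx \<gamma> n (of_real (d_pt n j))) \<le> C / real n ^ 3"
proof -
  (* delta is half of ln (1 / |gamma|), so that |gamma| exp delta = sqrt |gamma|. *)
  define r where "r = sqrt (cmod \<gamma>)"
  define \<delta> where "\<delta> = ln (1 / r)"
  define K where "K = r / (1 - r)"
  define C where "C = exp \<delta> * K ^ 3 + 2 * (r / (1 - r)\<^sup>2) * K\<^sup>2 + 4 * K ^ 3"
  have r: "0 < r" "r < 1" using assms by (auto simp: r_def)
  have rr: "cmod \<gamma> = r * r" using assms by (simp add: r_def)
  have g: "cmod \<gamma> * exp \<delta> = r" using r by (simp add: \<delta>_def rr)
  have \<delta>: "0 < \<delta>" using r by (simp add: \<delta>_def ln_div)
  have K: "0 < K" using r by (simp add: K_def)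
  have M: "K\<^sup>2 < M_const \<gamma>"
    using M_const_dominates[OF assms] by (simp add: K_def r_def)
  have C: "0 \<le> C" using r K by (simp add: C_def)
  have "(\<lambda>n. K / (real n + 1) + M_const \<gamma> / (real n + 1)\<^sup>2) \<longlonglongrightarrow> 0"
    by real_asymp
  then have "\<forall>\<^sub>F n in sequentially. K / (real n + 1) + M_const \<gamma> / (real n + 1)\<^sup>2 < \<delta>"
    using \<delta> by (rule order_tendstoD(2))
  moreover have "(\<lambda>n. K / (real n + 1)) \<longlonglongrightarrow> 0"
    by real_asymp
  then have "\<forall>\<^sub>F n in sequentially. K / (real n + 1) < 1"
    by (rule order_tendstoD(2)) simp
  ultimately have "\<forall>\<^sub>F n in sequentially. \<forall>j\<in>{1..n}.
           cmod (lambda_val \<gamma> n j - Lambda_approx \<gamma> n (of_real (d_pt n j))) \<le> C / real n ^ 3"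
    using eventually_gt_at_top[of 0]
  proof eventually_elim
    case (elim n)
    have "C / (real n + 1) ^ 3 \<le> C / real n ^ 3"
      using C elim(3) by (intro divide_left_mono power_mono) auto
    moreover have "cmod (lambda_val \<gamma> n j - Lambda_approx \<gamma> n (of_real (d_pt n j)))
                     \<le> C / (real n + 1) ^ 3" for j
      unfolding C_def
      by (rule expansion_at_s_pt[OF g r(2) K_def K M]) (use elim in auto)
    ultimately show ?case by (meson order_trans)
  qed
  then show ?thesis ..
qed

end
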